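(* Let $L$ be the set of quadruples $(a,b,c,d)\in\mathbb{C}^4$ with $ad-bc\neq 0$. Then $L$ is a group under the composition $$(a,b,c,d)\circ(a',b',c',d')=(aa'+bc',\ ab'+bd',\ ca'+dc',\ cb'+dd'),$$ with identity element $(1,0,0,1)$ and with the inverse of $(a,b,c,d)$ equal to $\left(\frac{d}{ad-bc},\frac{-b}{ad-bc},\frac{-c}{ad-bc},\frac{a}{ad-bc}\right)$.
   Context: Elements of $L$ are the coefficient quadruples of linear fractional (Möbius) transformations $z\mapsto\frac{az+b}{cz+d}$. Two elements of $L$ are equal exactly when all four coefficients agree. *)

theory Defs
  imports Complex_Main "HOL-Algebra.Group"
begin

type_synonym quadruple = "complex \<times> complex \<times> complex \<times> complex"

definition L :: "quadruple set" where
  "L = {(a, b, c, d). a * d - b * c \<noteq> 0}"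

fun quad_comp :: "quadruple \<Rightarrow> quadruple \<Rightarrow> quadruple" where
  "quad_comp (a, b, c, d) (a', b', c', d') =
     (a * a' + b * c', a * b' + b * d', c * a' + d * c', c * b' + d * d')"

definition L_group :: "quadruple monoid" where
  "L_group = \<lparr>carrier = L, monoid.mult = quad_comp, one = (1, 0, 0, 1)\<rparr>"

end

theory Submission
  imports Defs
begin

text \<open>Read (a, b, c, d) as the 2x2 matrix with rows (a, b) and (c, d):
  \<open>quad_comp\<close> is the matrix product and \<open>L\<close> consists of the invertible
  matrices, so the group is GL(2, C). Closure is multiplicativity of the determinant
  (\<open>quad_det_comp\<close>), associativity is a polynomial identity, and the inverse is the
  adjugate divided by the determinant (\<open>quad_comp_inv_left\<close>). Left inverses suffice for
  \<open>groupI\<close>, and uniqueness of inverses then yields the explicit formula.\<close>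

fun quad_det :: "quadruple \<Rightarrow> complex" where
  "quad_det (a, b, c, d) = a * d - b * c"

fun quad_inv :: "quadruple \<Rightarrow> quadruple" where
  "quad_inv (a, b, c, d) =
     (d / (a * d - b * c), - b / (a * d - b * c),
      - c / (a * d - b * c), a / (a * d - b * c))"

lemma mem_L_iff: "p \<in> L \<longleftrightarrow> quad_det p \<noteq> 0"
  by (cases p) (simp add: L_def)

lemma quad_det_comp: "quad_det (quad_comp p q) = quad_det p * quad_det q"
  by (cases p; cases q) (simp add: algebra_simps)

lemma quad_comp_assoc: "quad_comp (quad_comp p q) r = quad_comp p (quad_comp q r)"
  by (cases p; cases q; cases r) (simp add: algebra_simps)

lemma quad_comp_one_left: "quad_comp (1, 0, 0, 1) p = p"
  by (cases p) simp

lemma quad_comp_inv_left: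
  assumes "p \<in> L"
  shows "quad_comp (quad_inv p) p = (1, 0, 0, 1)"
proof (cases p)
  case (fields a b c d)
  define D where "D = a * d - b * c"
  have "D \<noteq> 0"
    using assms fields by (simp add: mem_L_iff D_def)
  moreover have "quad_inv p = (d / D, - b / D, - c / D, a / D)"
    by (simp add: fields D_def)
  \<comment> \<open>These are the numerators on the diagonal of the product; off the diagonal the
    terms cancel by commutativity.\<close>
  moreover have "d * a - b * c = D" "a * d - c * b = D"
    by (simp_all add: D_def mult.commute)
  ultimately show ?thesis
    by (simp add: fields mult.commute flip: diff_divide_distrib)
qed

text \<open>Taking determinants in \<open>quad_comp_inv_left\<close> gives a product equal to 1, so
  neither factor vanishes; the determinant of the inverse need not be computed.\<close>

lemma quad_inv_in_L:
  assumes "p \<in> L"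
  shows "quad_inv p \<in> L"
proof -
  have "quad_det (quad_inv p) * quad_det p = 1"
    using quad_comp_inv_left[OF assms] by (simp flip: quad_det_comp)
  then show ?thesis
    by (auto simp: mem_L_iff)
qed

lemma group_L_group: "group L_group"
proof (rule groupI)
  fix p assume "p \<in> carrier L_group"
  then show "\<exists>q\<in>carrier L_group. q \<otimes>\<^bsub>L_group\<^esub> p = \<one>\<^bsub>L_group\<^esub>"
    by (intro bexI[of _ "quad_inv p"]) (simp_all add: L_group_def quad_comp_inv_left quad_inv_in_L)
\<comment> \<open>Products stay folded, so that the lemmas on \<open>quad_comp\<close> can rewrite
  them.\<close>
qed (auto simp: L_group_def mem_L_iff quad_det_comp quad_comp_assoc quad_comp_one_left
    simp del: quad_comp.simps)

lemma inv_L_group: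
  assumes "p \<in> L"
  shows "inv\<^bsub>L_group\<^esub> p = quad_inv p"
  by (rule group.inv_equality[OF group_L_group])
    (simp_all add: L_group_def assms quad_inv_in_L quad_comp_inv_left)

theorem mainTheorem4:
  shows "group L_group \<and>
    \<one>\<^bsub>L_group\<^esub> = (1, 0, 0, 1) \<and>
    (\<forall>a b c d. (a, b, c, d) \<in> L \<longrightarrow>
      inv\<^bsub>L_group\<^esub> (a, b, c, d) =
        (d / (a * d - b * c), - b / (a * d - b * c),
         - c / (a * d - b * c), a / (a * d - b * c)))"
  \<comment> \<open>\<open>L_group\<close> is unfolded only after the inverse is rewritten, since
    \<open>inv_L_group\<close> matches the folded constant.\<close>
  using group_L_group by (simp add: inv_L_group) (simp add: L_group_def)

end
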